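(* Let $\{\mathbf{X}_1,\dots,\mathbf{X}_n\}$ and $\{\mathbf{Y}_1,\dots,\mathbf{Y}_n\}$ be sets of two-dimensional random vectors. Suppose there exists $\lambda\in\Delta^n$ such that $\sum_{i=1}^n\lambda_i\mathbf{X}_i\succ_d\sum_{i=1}^n\lambda_i\mathbf{Y}_i$. Then for every $u\in\mathcal{U}$ with $\frac{\partial^2u(x_1,x_2)}{\partial x_1\partial x_2}\le 0$ there exists $i\in\{1,\dots,n\}$ with $\mathbb{E}\,u(\mathbf{X}_i)>\mathbb{E}\,u(\mathbf{Y}_i)$.
   Context: $\Delta^n=\{\lambda\in\mathbb{R}^n:\lambda_i\ge0,\ \sum_i\lambda_i=1\}$. For $\lambda\in\Delta^n$, $\sum_i\lambda_i\mathbf{X}_i$ denotes the mixture distribution (with probability law $\sum_i\lambda_i\,\mathrm{Law}(\mathbf{X}_i)$, so its CDF is $\sum_i\lambda_iF_{\mathbf{X}_i}$). For $\mathbf{x},\mathbf{y}\in\mathbb{R}^2$: $\mathbf{y}\preceq_p\mathbf{x}$ iff $y_i\le x_i$ for all $i$; $\mathbf{x}\succ_p\mathbf{y}$ iff $x_i\ge y_i$ for all $i$ and $x_i>y_i$ for some $i$. $\mathcal{U}$ is the class of strictly monotonically increasing $u:\mathbb{R}^2\to\mathbb{R}$ ($\mathbf{x}\succ_p\mathbf{y}\implies u(\mathbf{x})>u(\mathbf{y})$). CDF: $F_{\mathbf{X}}(\mathbf{x})=P(\mathbf{X}\preceq_p\mathbf{x})$. $\mathbf{X}\succeq_{\mathrm{FSD}}\mathbf{Y}$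 iff $F_{\mathbf{X}}\le F_{\mathbf{Y}}$ pointwise; $\mathbf{X}\succ_{\mathrm{FSD}}\mathbf{Y}$ iff additionally strict inequality at some point (same for real random variables). $\mathbf{X}\succ_d\mathbf{Y}$ iff $\mathbf{X}\succeq_{\mathrm{FSD}}\mathbf{Y}$ and $X_j\succ_{\mathrm{FSD}}Y_j$ for some marginal $j$. All expectations appearing are assumed to exist. *)

theory Defs
  imports "HOL-Probability.Probability"
begin

text \<open>Bivariate random vectors are represented by their laws: probability measures
on the Borel sets of real \<times> real.\<close>

definition std_simplex :: "nat \<Rightarrow> (nat \<Rightarrow> real) set" where
  "std_simplex n = {lam. (\<forall>i<n. 0 \<le> lam i) \<and> (\<Sum>i<n. lam i) = 1}"

definition pareto_gt :: "real \<times> real \<Rightarrow> real \<times> real \<Rightarrow> bool" where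
  "pareto_gt x y \<longleftrightarrow> fst x \<ge> fst y \<and> snd x \<ge> snd y \<and> (fst x > fst y \<or> snd x > snd y)"

definition strictly_incr :: "(real \<times> real \<Rightarrow> real) \<Rightarrow> bool" where
  "strictly_incr u \<longleftrightarrow> (\<forall>x y. pareto_gt x y \<longrightarrow> u x > u y)"

definition mixed_partial_nonpos :: "(real \<times> real \<Rightarrow> real) \<Rightarrow> bool" where
  "mixed_partial_nonpos u \<longleftrightarrow>
     (\<forall>a b. (\<lambda>t. u (t, b)) differentiable (at a)) \<and>
     (\<forall>a b. \<exists>d. ((\<lambda>s. deriv (\<lambda>t. u (t, s)) a) has_real_derivative d) (at b) \<and> d \<le> 0)"

definition cdf2 :: "(real \<times> real) measure \<Rightarrow> real \<times> real \<Rightarrow> real" where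
  "cdf2 M x = measure M {y. fst y \<le> fst x \<and> snd y \<le> snd x}"

definition coord :: "nat \<Rightarrow> real \<times> real \<Rightarrow> real" where
  "coord j y = (if j = 1 then fst y else snd y)"

definition marg_cdf :: "nat \<Rightarrow> (real \<times> real) measure \<Rightarrow> real \<Rightarrow> real" where
  "marg_cdf j M t = measure M {y. coord j y \<le> t}"

text \<open>CDFs of the mixture sum_i lam_i X_i (law sum_i lam_i Law(X_i)).\<close>
definition mix_cdf :: "nat \<Rightarrow> (nat \<Rightarrow> real) \<Rightarrow> (nat \<Rightarrow> (real \<times> real) measure) \<Rightarrow> real \<times> real \<Rightarrow> real" where
  "mix_cdf n lam M x = (\<Sum>i<n. lam i * cdf2 (M i) x)"

definition mix_marg_cdf :: "nat \<Rightarrow> (nat \<Rightarrow> real) \<Rightarrow> (nat \<Rightarrow> (real \<times> real) measure) \<Rightarrow> nat \<Rightarrow> real \<Rightarrow> real" where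
  "mix_marg_cdf n lam M j t = (\<Sum>i<n. lam i * marg_cdf j (M i) t)"

text \<open>X \<succeq>_FSD Y for CDFs F_X, F_Y (any dimension): F_X \<le> F_Y pointwise.\<close>
definition fsd_ge :: "('a \<Rightarrow> real) \<Rightarrow> ('a \<Rightarrow> real) \<Rightarrow> bool" where
  "fsd_ge FX FY \<longleftrightarrow> (\<forall>x. FX x \<le> FY x)"

definition fsd_gt :: "('a \<Rightarrow> real) \<Rightarrow> ('a \<Rightarrow> real) \<Rightarrow> bool" where
  "fsd_gt FX FY \<longleftrightarrow> fsd_ge FX FY \<and> (\<exists>x. FX x < FY x)"

definition mix_succ_d :: "nat \<Rightarrow> (nat \<Rightarrow> real) \<Rightarrow> (nat \<Rightarrow> (real \<times> real) measure) \<Rightarrow> (nat \<Rightarrow> (real \<times> real) measure) \<Rightarrow> bool" where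
  "mix_succ_d n lam X Y \<longleftrightarrow>
     fsd_ge (mix_cdf n lam X) (mix_cdf n lam Y) \<and>
     (\<exists>j\<in>{1,2}. fsd_gt (mix_marg_cdf n lam X j) (mix_marg_cdf n lam Y j))"

end

theory Submission
  imports Defs
begin

text \<open>A utility with nonpositive mixed partial derivative is submodular and continuous in its
  first coordinate. Replacing it by a step function of that coordinate writes it as an increasing
  function of the second coordinate minus a sum of products of an indicator of
  \<open>{x. x \<le> s}\<close> and a nonnegative antitone function of \<open>y\<close>, hence minus a positive
  combination of indicators of lower orthants up to a constant. So pointwise ordered
  CDFs give ordered expectations.

  Strictness comes from spare room in the CDF inequality: if, say, the first marginal inequality
  is strict at \<open>t0\<close>, then for some \<open>t1 > t0\<close>, some \<open>T\<close> and some \<open>d > 0\<close> the CDFs stay ordered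
  after adding a mass \<open>d\<close> at \<open>(t0, T)\<close> to the better mixture and at \<open>(t1, T)\<close> to the worse one.
  The expectations therefore differ by at least \<open>d * (u (t1, T) - u (t0, T)) > 0\<close>.\<close>

section \<open>Two tools on the real line: lower sets and summation by parts\<close>

text \<open>A nonempty lower set is a closed ray, the whole line or an open ray. The endpoints
  \<open>a k\<close> are then constantly the maximum, the naturals, or
  \<open>Sup A - 1 / real (Suc k)\<close>. This carries statements about closed orthants over to
  products of arbitrary lower sets.\<close>

lemma lower_set_indicator_limit:
  fixes A :: "real set"
  assumes "A \<noteq> {}" and lower: "\<And>x y. y \<in> A \<Longrightarrow> x \<le> y \<Longrightarrow> x \<in> A"
  obtains a :: "nat \<Rightarrow> real"
  where "\<And>x. (\<lambda>k. indicator {..a k} x :: real) \<longlonglongrightarrow> indicator A x"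
proof -
  note witness = that
  have *: thesis if a: "\<And>k. a k \<in> A" "\<And>x. x \<in> A \<Longrightarrow> \<forall>\<^sub>F k in sequentially. x \<le> a k"
    for a :: "nat \<Rightarrow> real"
  proof (rule witness)
    fix x
    have "\<forall>\<^sub>F k in sequentially. (indicator {..a k} x :: real) = indicator A x"
    proof (cases "x \<in> A")
      case True
      show ?thesis
        using a(2)[OF True] by eventually_elim (use True in auto)
    next
      case False
      then have "\<not> x \<le> a k" for k
        using lower a(1) by blast
      then show ?thesis
        using False by auto
    qed
    then show "(\<lambda>k. indicator {..a k} x :: real) \<longlonglongrightarrow> indicator A x"
      by (rule tendsto_eventually)
  qed
  consider "\<exists>m\<in>A. \<forall>x\<in>A. x \<le> m" | "\<not> bdd_above A"
    | "bdd_above A" "\<forall>m\<in>A. \<exists>x\<in>A. m < x"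
    by (metis not_le)
  then show thesis
  proof cases
    case 1
    then obtain m where "m \<in> A" "\<forall>x\<in>A. x \<le> m" by blast
    then show ?thesis using *[of "\<lambda>_. m"] by auto
  next
    case 2
    then have "\<exists>x\<in>A. c < x" for c
      by (meson bdd_above.I not_le)
    then have "real k \<in> A" for k
      using lower by (meson less_imp_le)
    moreover have "\<forall>\<^sub>F k in sequentially. x \<le> real k" for x
      using filterlim_real_sequentially by (simp add: filterlim_at_top)
    ultimately show ?thesis by (rule *[of real])
  next
    case 3
    have "Sup A - 1 / real (Suc k) \<in> A" for k
    proof -
      have "Sup A - 1 / real (Suc k) < Sup A" by simp
      then obtain x where "x \<in> A" "Sup A - 1 / real (Suc k) < x"
        using less_cSup_iff[OF \<open>A \<noteq> {}\<close> \<open>bdd_above A\<close>] by blast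
      then show ?thesis
        using lower less_imp_le by blast
    qed
    moreover have "\<forall>\<^sub>F k in sequentially. x \<le> Sup A - 1 / real (Suc k)" if x: "x \<in> A" for x
    proof -
      obtain y where "y \<in> A" "x < y" using 3(2) x by blast
      then have "x < Sup A" using cSup_upper[OF _ 3(1)] by force
      have "(\<lambda>k. Sup A - 1 / real (Suc k)) \<longlonglongrightarrow> Sup A - 0"
        using LIMSEQ_inverse_real_of_nat
        by (intro tendsto_diff tendsto_const) (simp add: inverse_eq_divide)
      then have "\<forall>\<^sub>F k in sequentially. x < Sup A - 1 / real (Suc k)"
        by (rule order_tendstoD) (use \<open>x < Sup A\<close> in simp)
      then show ?thesis by (rule eventually_mono) simp
    qed
    ultimately show ?thesis by (rule *)
  qed
qed

text \<open>The telescoping sum from \<open>k\<close> to \<open>N\<close> is written over a fixed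
  range, so that a \<open>k\<close> depending on a point occurs only in a 0/1 factor. That factor
  later becomes the indicator of a ray.\<close>

lemma sum_telescope_from:
  fixes f :: "nat \<Rightarrow> real"
  assumes "k \<le> N"
  shows "f N - (\<Sum>j<N. of_bool (k \<le> j) * (f (Suc j) - f j)) = f k"
  using assms
proof (induction N)
  case (Suc N)
  show ?case
  proof (cases "k \<le> N")
    case True
    then show ?thesis using Suc.IH by simp
  next
    case False
    then have "k = Suc N" using Suc.prems by simp
    then show ?thesis by (simp add: sum.neutral)
  qed
qed simp

section \<open>Submodular utilities and their truncations\<close>

text \<open>Monotonicity is weak so that truncations stay in the class. Continuity concerns the
  first coordinate alone because only that one is discretised.\<close>

definition submodular_utility :: "(real \<times> real \<Rightarrow> real) \<Rightarrow> bool" where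
  "submodular_utility w \<longleftrightarrow> w \<in> borel_measurable borel \<and>
     (\<forall>x x' y y'. x \<le> x' \<longrightarrow> y \<le> y' \<longrightarrow> w (x, y) \<le> w (x', y')) \<and>
     (\<forall>x x' y y'. x \<le> x' \<longrightarrow> y \<le> y' \<longrightarrow> w (x', y') + w (x, y) \<le> w (x', y) + w (x, y')) \<and>
     (\<forall>x y. isCont (\<lambda>x. w (x, y)) x)"

text \<open>An increasing concave function of an increasing submodular function is again submodular.
  Subtracting \<open>K\<close> makes the result nonpositive.\<close>

lemma submodular_utility_min:
  assumes "submodular_utility w"
  shows "submodular_utility (\<lambda>p. min (w p) K - K)"
  unfolding submodular_utility_def
proof (intro conjI allI impI)
  fix x x' y y' :: real
  assume le: "x \<le> x'" "y \<le> y'"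
  then have "w (x, y) \<le> w (x', y)" "w (x, y) \<le> w (x, y')"
    "w (x', y) \<le> w (x', y')" "w (x, y') \<le> w (x', y')"
    "w (x', y') + w (x, y) \<le> w (x', y) + w (x, y')"
    using assms by (auto simp: submodular_utility_def)
  then show "min (w (x', y')) K - K + (min (w (x, y)) K - K)
      \<le> min (w (x', y)) K - K + (min (w (x, y')) K - K)"
    and "min (w (x, y)) K - K \<le> min (w (x', y')) K - K"
    by linarith+
next
  show "(\<lambda>p. min (w p) K - K) \<in> borel_measurable borel"
    using assms by (auto simp: submodular_utility_def)
  show "isCont (\<lambda>x. min (w (x, y)) K - K) x" for x y
    using assms by (auto simp: submodular_utility_def intro!: continuous_intros)
qed

text \<open>Clamping is increasing and continuous in each coordinate, so it maps the corners of a
  rectangle to those of a possibly degenerate rectangle.\<close>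

lemma submodular_utility_max_coords:
  assumes "submodular_utility w"
  shows "submodular_utility (\<lambda>p. w (max (fst p) L, max (snd p) L))"
  unfolding submodular_utility_def
proof (intro conjI allI impI)
  have [measurable]: "w \<in> borel_measurable borel"
    using assms by (auto simp: submodular_utility_def)
  have "(\<lambda>p. (max (fst p) L, max (snd p) L)) \<in> borel \<rightarrow>\<^sub>M (borel :: (real \<times> real) measure)"
    unfolding borel_prod[symmetric] by measurable
  then show "(\<lambda>p. w (max (fst p) L, max (snd p) L)) \<in> borel_measurable borel"
    by measurable
  show "isCont (\<lambda>x. w (max (fst (x, y)) L, max (snd (x, y)) L)) x" for x y
    unfolding fst_conv snd_conv
    by (rule isCont_o2[where f = "\<lambda>x. max x L" and g = "\<lambda>x. w (x, max y L)"])
       (use assms in \<open>auto simp: submodular_utility_def intro!: continuous_intros\<close>)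
qed (use assms in \<open>auto simp: submodular_utility_def max.coboundedI1\<close>)

section \<open>Integrals against a signed combination of laws\<close>

text \<open>This is the integral of \<open>f\<close> against the signed measure with weights
  \<open>a i\<close> on \<open>M i\<close>. The index type is arbitrary so that Dirac masses can
  later join the two mixtures.\<close>

definition signed_ev ::
    "'i set \<Rightarrow> ('i \<Rightarrow> real) \<Rightarrow> ('i \<Rightarrow> (real \<times> real) measure) \<Rightarrow> (real \<times> real \<Rightarrow> real) \<Rightarrow> real" where
  "signed_ev I a M f = (\<Sum>i\<in>I. a i * (\<integral>p. f p \<partial>M i))"

context
  fixes I :: "'i set" and a :: "'i \<Rightarrow> real" and M :: "'i \<Rightarrow> (real \<times> real) measure"
  assumes finite_I: "finite I"
    and prob: "\<And>i. i \<in> I \<Longrightarrow> prob_space (M i)"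
    and sets_M: "\<And>i. i \<in> I \<Longrightarrow> sets (M i) = sets borel"
    and total: "sum a I = 0"
    and orthant: "\<And>p. 0 \<le> (\<Sum>i\<in>I. a i * cdf2 (M i) p)"
begin

lemma measurable_M: "i \<in> I \<Longrightarrow> f \<in> borel_measurable borel \<Longrightarrow> f \<in> borel_measurable (M i)"
  using measurable_cong_sets[OF sets_M refl] by blast

lemma integrable_bounded:
  fixes f :: "real \<times> real \<Rightarrow> real"
  assumes "i \<in> I" "f \<in> borel_measurable borel" "\<And>p. \<bar>f p\<bar> \<le> B"
  shows "integrable (M i) f"
proof -
  interpret prob_space "M i" using prob[OF assms(1)] .
  show ?thesis
    by (rule integrable_const_bound[where B = B]) (use assms measurable_M in auto)
qed

lemma signed_ev_const: "signed_ev I a M (\<lambda>_. c) = 0"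
proof -
  have "(\<integral>p. c \<partial>M i) = c" if "i \<in> I" for i
    using prob_space.prob_space[OF prob[OF that]] by simp
  then have "signed_ev I a M (\<lambda>_. c) = (\<Sum>i\<in>I. a i * c)"
    unfolding signed_ev_def by (intro sum.cong) simp_all
  also have "\<dots> = sum a I * c"
    by (simp add: sum_distrib_right)
  finally show ?thesis
    by (simp add: total)
qed

lemma signed_ev_diff:
  assumes "\<And>i. i \<in> I \<Longrightarrow> integrable (M i) f" "\<And>i. i \<in> I \<Longrightarrow> integrable (M i) g"
  shows "signed_ev I a M (\<lambda>p. f p - g p) = signed_ev I a M f - signed_ev I a M g"
  using assms by (simp add: signed_ev_def right_diff_distrib sum_subtractf)

lemma signed_ev_sum:
  assumes "\<And>i j. i \<in> I \<Longrightarrow> j \<in> J \<Longrightarrow> integrable (M i) (f j)"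
  shows "signed_ev I a M (\<lambda>p. \<Sum>j\<in>J. f j p) = (\<Sum>j\<in>J. signed_ev I a M (f j))"
proof -
  have "signed_ev I a M (\<lambda>p. \<Sum>j\<in>J. f j p) = (\<Sum>i\<in>I. \<Sum>j\<in>J. a i * (\<integral>p. f j p \<partial>M i))"
    using assms by (simp add: signed_ev_def sum_distrib_left)
  then show ?thesis
    unfolding signed_ev_def by (subst (asm) sum.swap)
qed

lemma signed_ev_cmult: "signed_ev I a M (\<lambda>p. c * f p) = c * signed_ev I a M f"
  by (simp add: signed_ev_def sum_distrib_left mult.left_commute)

text \<open>Dominated convergence under each \<open>M i\<close>, with one dominating function
  \<open>B\<close> for all of them.\<close>

lemma signed_ev_limit:
  assumes "\<And>k. f k \<in> borel_measurable borel"
    and "\<And>p. (\<lambda>k. f k p) \<longlonglongrightarrow> F p"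
    and "\<And>k p. \<bar>f k p\<bar> \<le> B p"
    and "\<And>i. i \<in> I \<Longrightarrow> integrable (M i) B"
  shows "(\<lambda>k. signed_ev I a M (f k)) \<longlonglongrightarrow> signed_ev I a M F"
  unfolding signed_ev_def
proof (intro tendsto_sum tendsto_mult tendsto_const)
  fix i assume i: "i \<in> I"
  have F: "F \<in> borel_measurable borel"
    by (rule borel_measurable_LIMSEQ_real[OF assms(2) assms(1)])
  show "(\<lambda>k. \<integral>p. f k p \<partial>M i) \<longlonglongrightarrow> (\<integral>p. F p \<partial>M i)"
  proof (rule integral_dominated_convergence)
    show "integrable (M i) B"
      by (rule assms(4)[OF i])
  qed (simp_all add: measurable_M[OF i] assms(1-3) F)
qed

lemma signed_ev_limit_nonneg:
  assumes "\<And>k. f k \<in> borel_measurable borel"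
    and "\<And>p. (\<lambda>k. f k p) \<longlonglongrightarrow> F p"
    and "\<And>k p. \<bar>f k p\<bar> \<le> B p"
    and "\<And>i. i \<in> I \<Longrightarrow> integrable (M i) B"
    and "\<And>k. 0 \<le> signed_ev I a M (f k)"
  shows "0 \<le> signed_ev I a M F"
  using LIMSEQ_le_const[OF signed_ev_limit[OF assms(1-4)]] assms(5) by blast

lemma signed_ev_limit_nonpos:
  assumes "\<And>k. f k \<in> borel_measurable borel"
    and "\<And>p. (\<lambda>k. f k p) \<longlonglongrightarrow> F p"
    and "\<And>k p. \<bar>f k p\<bar> \<le> B p"
    and "\<And>i. i \<in> I \<Longrightarrow> integrable (M i) B"
    and "\<And>k. signed_ev I a M (f k) \<le> 0"
  shows "signed_ev I a M F \<le> 0"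
  using LIMSEQ_le_const2[OF signed_ev_limit[OF assms(1-4)]] assms(5) by blast

section \<open>From lower orthants to products with antitone functions\<close>

text \<open>The CDF hypothesis \<open>orthant\<close> enters here: the product is the indicator of a
  lower orthant, whose integral is a value of \<open>cdf2\<close>.\<close>

lemma signed_ev_orthant_nonneg: "0 \<le> signed_ev I a M (\<lambda>p. indicator {..s} (fst p) * indicator {..t} (snd p))"
proof -
  have *: "(\<integral>p. indicator {..s} (fst p) * indicator {..t} (snd p) \<partial>M i) = cdf2 (M i) (s, t)"
    if "i \<in> I" for i
  proof -
    let ?S = "{p :: real \<times> real. fst p \<le> s \<and> snd p \<le> t}"
    have "(\<integral>p. indicator {..s} (fst p) * indicator {..t} (snd p) \<partial>M i)
        = (\<integral>p. indicat_real ?S p \<partial>M i)"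
      by (intro Bochner_Integration.integral_cong) (auto split: split_indicator)
    also have "\<dots> = measure (M i) (?S \<inter> space (M i))"
      by simp
    also have "space (M i) = UNIV"
      using sets_eq_imp_space_eq[OF sets_M[OF that]] by simp
    finally show ?thesis
      by (simp add: cdf2_def)
  qed
  show ?thesis
    using orthant[of "(s, t)"] by (simp add: signed_ev_def * cong: sum.cong)
qed

lemma signed_ev_lower_sets_nonneg:
  assumes A: "\<And>x y. y \<in> A \<Longrightarrow> x \<le> y \<Longrightarrow> x \<in> A"
    and B: "\<And>x y. y \<in> B \<Longrightarrow> x \<le> y \<Longrightarrow> x \<in> B"
  shows "0 \<le> signed_ev I a M (\<lambda>p. indicator A (fst p) * indicator B (snd p))"
proof (cases "A = {} \<or> B = {}")
  case True
  then show ?thesis by (auto simp: signed_ev_def)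
next
  case False
  obtain s where s: "\<And>x. (\<lambda>k. indicator {..s k} x :: real) \<longlonglongrightarrow> indicator A x"
    by (rule lower_set_indicator_limit[of A]) (use A False in blast)+
  obtain t where t: "\<And>x. (\<lambda>k. indicator {..t k} x :: real) \<longlonglongrightarrow> indicator B x"
    by (rule lower_set_indicator_limit[of B]) (use B False in blast)+
  show ?thesis
  proof (rule signed_ev_limit_nonneg)
    show "(\<lambda>p. indicator {..s k} (fst p) * indicator {..t k} (snd p) :: real) \<in> borel_measurable borel" for k
      unfolding borel_prod[symmetric] by measurable
    show "(\<lambda>k. indicator {..s k} (fst p) * indicator {..t k} (snd p))
        \<longlonglongrightarrow> (indicator A (fst p) * indicator B (snd p) :: real)" for p
      by (intro tendsto_mult s t)
    show "\<bar>indicator {..s k} (fst p) * indicator {..t k} (snd p)\<bar> \<le> (1 :: real)" for k p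
      by (auto split: split_indicator)
    show "integrable (M i) (\<lambda>_. 1 :: real)" if "i \<in> I" for i
      by (rule integrable_bounded[OF that, of _ 1]) auto
  qed (auto intro: signed_ev_orthant_nonneg)
qed

text \<open>Layer-cake argument: a nonnegative antitone function is a uniform limit of positive
  combinations of indicators of lower sets.\<close>

lemma signed_ev_lower_set_antimono_nonneg:
  fixes h :: "real \<Rightarrow> real"
  assumes A: "\<And>x y. y \<in> A \<Longrightarrow> x \<le> y \<Longrightarrow> x \<in> A" "A \<in> sets borel"
    and h: "antimono h" "\<And>y. 0 \<le> h y" "\<And>y. h y \<le> C"
  shows "0 \<le> signed_ev I a M (\<lambda>p. indicator A (fst p) * h (snd p))"
proof -
  have [measurable]: "h \<in> borel_measurable borel"
  proof -
    have "mono (\<lambda>y. - h y)"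
      using h(1) by (auto simp: mono_def antimono_def)
    then have "(\<lambda>y. - h y) \<in> borel_measurable borel"
      by (rule borel_measurable_mono)
    then show ?thesis by simp
  qed
  note [measurable] = A(2)
  have C: "0 \<le> C" using h(2,3) order_trans by blast
  \<comment> \<open>Superlevel sets of an antitone function are lower sets. The heights start at
    \<open>1 / real (Suc k)\<close>, since height 0 would count every point once too often.\<close>
  define B where "B k j = {y. real (Suc j) / real (Suc k) \<le> h y}" for k j
  have [measurable]: "B k j \<in> sets borel" for k j
    unfolding B_def by measurable
  define N where "N k = nat \<lfloor>real (Suc k) * C\<rfloor>" for k
  define H where "H k y = (\<Sum>j<N k. 1 / real (Suc k) * indicator (B k j) y)" for k y
  \<comment> \<open>Counting the levels below \<open>h y\<close> rounds \<open>h y\<close> down to a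
    multiple of \<open>1 / real (Suc k)\<close>. The bound \<open>C\<close> ensures that
    \<open>N k\<close> levels suffice.\<close>
  have H: "H k y = real_of_int \<lfloor>real (Suc k) * h y\<rfloor> / real (Suc k)" for k y
  proof -
    define l where "l = nat \<lfloor>real (Suc k) * h y\<rfloor>"
    have "l \<le> N k"
      unfolding l_def N_def using h(3)
      by (intro nat_mono floor_mono mult_left_mono) auto
    have ind: "indicator (B k j) y = (of_bool (j < l) :: real)" for j
    proof -
      have "real (Suc j) / real (Suc k) \<le> h y \<longleftrightarrow> real (Suc j) \<le> real (Suc k) * h y"
        by (simp add: field_simps)
      also have "\<dots> \<longleftrightarrow> Suc j \<le> l"
        unfolding l_def by (metis le_nat_floor le_nat_iff of_int_of_nat_eq of_nat_0_le_iff le_floor_iff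
            zero_le_floor h(2) mult_nonneg_nonneg)
      finally show ?thesis
        by (auto simp: B_def indicator_def)
    qed
    have "H k y = (\<Sum>j<N k. of_bool (j < l)) / real (Suc k)"
      unfolding H_def ind sum_divide_distrib by simp
    also have "(\<Sum>j<N k. of_bool (j < l) :: real) = (\<Sum>j\<in>{..<N k} \<inter> {j. j < l}. 1)"
      by (subst sum.inter_restrict) (auto simp: of_bool_def)
    also have "{..<N k} \<inter> {j. j < l} = {..<l}"
      using \<open>l \<le> N k\<close> by auto
    finally show ?thesis
      using h(2)[of y] by (simp add: l_def)
  qed
  have close: "\<bar>H k y - h y\<bar> \<le> 1 / real (Suc k)" for k y
  proof -
    have "H k y - h y = (real_of_int \<lfloor>real (Suc k) * h y\<rfloor> - real (Suc k) * h y) / real (Suc k)"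
      unfolding H by (simp add: diff_divide_distrib del: of_nat_Suc)
    moreover have "\<bar>real_of_int \<lfloor>real (Suc k) * h y\<rfloor> - real (Suc k) * h y\<bar> \<le> 1"
      by linarith
    ultimately show ?thesis
      by (simp add: divide_right_mono del: of_nat_Suc)
  qed
  have lim: "(\<lambda>k. H k y) \<longlonglongrightarrow> h y" for y
  proof -
    have "(\<lambda>k. 1 / real (Suc k)) \<longlonglongrightarrow> 0"
      using LIMSEQ_inverse_real_of_nat by (simp add: inverse_eq_divide)
    then have "(\<lambda>k. H k y - h y) \<longlonglongrightarrow> 0"
      by (rule Lim_null_comparison[rotated]) (use close in auto)
    then show ?thesis by (rule LIM_zero_cancel)
  qed
  show ?thesis
  proof (rule signed_ev_limit_nonneg)
    show "(\<lambda>p. indicator A (fst p) * H k (snd p)) \<in> borel_measurable borel" for k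
      unfolding H_def borel_prod[symmetric] by measurable
    show "(\<lambda>k. indicator A (fst p) * H k (snd p)) \<longlonglongrightarrow> indicator A (fst p) * h (snd p)" for p
      by (intro tendsto_mult tendsto_const lim)
    show "\<bar>indicator A (fst p) * H k (snd p)\<bar> \<le> C + 1" for k p
    proof -
      have "1 / real (Suc k) \<le> 1" by simp
      then have "\<bar>H k (snd p)\<bar> \<le> C + 1"
        using close[of k "snd p"] h(2,3)[of "snd p"] by linarith
      then show ?thesis using C by (auto split: split_indicator)
    qed
    show "integrable (M i) (\<lambda>_. C + 1)" if "i \<in> I" for i
      by (rule integrable_bounded[OF that, of _ "\<bar>C + 1\<bar>"]) auto
    show "0 \<le> signed_ev I a M (\<lambda>p. indicator A (fst p) * H k (snd p))" for k
    proof -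
      have "integrable (M i) (\<lambda>p. 1 / real (Suc k) * (indicator A (fst p) * indicator (B k j) (snd p)))"
        if "i \<in> I" for i j
        by (rule integrable_bounded[OF that, of _ 1])
           (auto simp: borel_prod[symmetric] split: split_indicator)
      then have "signed_ev I a M (\<lambda>p. \<Sum>j<N k. 1 / real (Suc k) * (indicator A (fst p) * indicator (B k j) (snd p)))
          = (\<Sum>j<N k. 1 / real (Suc k) * signed_ev I a M (\<lambda>p. indicator A (fst p) * indicator (B k j) (snd p)))"
        by (subst signed_ev_sum) (auto simp only: signed_ev_cmult)
      also have "\<dots> \<ge> 0"
        using A(1) h(1) by (intro sum_nonneg mult_nonneg_nonneg signed_ev_lower_sets_nonneg)
          (auto simp: B_def antimono_def intro: order_trans)
      finally show ?thesis
        by (simp add: H_def sum_distrib_left mult_ac)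
    qed
  qed
qed

section \<open>Expectations of submodular utilities\<close>

text \<open>The first coordinate is rounded up to a grid and the resulting step function is summed
  by parts. Its increments \<open>D m j\<close> are nonnegative by monotonicity and antitone by
  submodularity, so the layer-cake lemma applies to each term.\<close>

lemma signed_ev_bounded_submodular_nonpos:
  assumes w: "submodular_utility w" and bounded: "\<And>p. \<bar>w p\<bar> \<le> C"
  shows "signed_ev I a M w \<le> 0"
proof -
  have incr: "x \<le> x' \<Longrightarrow> y \<le> y' \<Longrightarrow> w (x, y) \<le> w (x', y')"
    and submod: "x \<le> x' \<Longrightarrow> y \<le> y' \<Longrightarrow> w (x', y') + w (x, y) \<le> w (x', y) + w (x, y')"
    and cont: "isCont (\<lambda>x. w (x, y)) x" for x x' y y'
    using w by (auto simp: submodular_utility_def)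
  have [measurable]: "(\<lambda>y. w (x, y)) \<in> borel_measurable borel" for x
    by (rule borel_measurable_mono) (auto simp: mono_def intro: incr)
  have C: "0 \<le> C" using bounded[of 0] by linarith

  \<comment> \<open>The grid runs from \<open>- real (Suc m)\<close> to \<open>real (Suc m)\<close>
    in steps of \<open>1 / real (Suc m)\<close>. The index \<open>k m x\<close> rounds
    \<open>x\<close> up; \<open>nat\<close> and \<open>min\<close> send points outside the grid to
    its ends.\<close>
  define N where "N m = 2 * Suc m * Suc m" for m
  define g where "g m j = real j / real (Suc m) - real (Suc m)" for m j
  define k where "k m x = min (nat \<lceil>real (Suc m) * (x + real (Suc m))\<rceil>) (N m)" for m x
  have g_mono: "g m i \<le> g m j" if "i \<le> j" for m i j
    using that by (simp add: g_def divide_right_mono del: of_nat_Suc)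
  \<comment> \<open>At \<open>j = N m\<close> the equivalence would fail for \<open>x\<close> beyond
    the grid, because \<open>k m x\<close> is capped there.\<close>
  have k_le: "k m x \<le> j \<longleftrightarrow> x \<le> g m j" if "j < N m" for m x j
  proof -
    have "k m x \<le> j \<longleftrightarrow> real (Suc m) * (x + real (Suc m)) \<le> real j"
      using that by (auto simp: k_def min_le_iff_disj nat_le_iff ceiling_le_iff simp del: of_nat_Suc)
    also have "\<dots> \<longleftrightarrow> x \<le> g m j"
      by (simp add: g_def field_simps del: of_nat_Suc)
    finally show ?thesis .
  qed
  define W where "W m p = w (g m (k m (fst p)), snd p)" for m p
  define D where "D m j y = w (g m (Suc j), y) - w (g m j, y)" for m j y
  have D: "antimono (D m j)" "0 \<le> D m j y" "D m j y \<le> 2 * C" for m j y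
  proof -
    have le: "g m j \<le> g m (Suc j)" by (rule g_mono) simp
    show "antimono (D m j)"
      using submod[OF le] by (auto simp: antimono_def D_def algebra_simps)
    show "0 \<le> D m j y"
      using incr[OF le, of y y] by (simp add: D_def)
    show "D m j y \<le> 2 * C"
      using bounded[of "(g m (Suc j), y)"] bounded[of "(g m j, y)"] by (simp add: D_def)
  qed
  have [measurable]: "D m j \<in> borel_measurable borel" for m j
    unfolding D_def by measurable
  have W_eq: "W m p = w (g m (N m), snd p)
      - (\<Sum>j<N m. indicator {..g m j} (fst p) * D m j (snd p))" for m p
  proof -
    have "k m (fst p) \<le> N m" by (simp add: k_def)
    from sum_telescope_from[OF this, of "\<lambda>j. w (g m j, snd p)"]
    have "W m p = w (g m (N m), snd p) - (\<Sum>j<N m. of_bool (k m (fst p) \<le> j) * D m j (snd p))"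
      unfolding W_def D_def by (rule sym)
    also have "(\<Sum>j<N m. of_bool (k m (fst p) \<le> j) * D m j (snd p))
        = (\<Sum>j<N m. indicator {..g m j} (fst p) * D m j (snd p))"
      by (intro sum.cong) (auto simp: k_le indicator_def)
    finally show ?thesis .
  qed
  have int1: "integrable (M i) (\<lambda>p. w (x, snd p))" if "i \<in> I" for i x
    by (rule integrable_bounded[OF that, of _ C])
       (use bounded in \<open>auto simp: borel_prod[symmetric]\<close>)
  have int2: "integrable (M i) (\<lambda>p. indicator {..g m j} (fst p) * D m j (snd p))"
    if "i \<in> I" for i m j
    by (rule integrable_bounded[OF that, of _ "2 * C"])
       (use D C in \<open>auto simp: borel_prod[symmetric] split: split_indicator\<close>)
  have evW: "signed_ev I a M (W m) \<le> 0" for m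
  proof -
    have "signed_ev I a M (W m) = signed_ev I a M (\<lambda>p. w (g m (N m), snd p))
        - signed_ev I a M (\<lambda>p. \<Sum>j<N m. indicator {..g m j} (fst p) * D m j (snd p))"
      unfolding W_eq by (intro signed_ev_diff Bochner_Integration.integrable_sum int1 int2)
    also have "signed_ev I a M (\<lambda>p. \<Sum>j<N m. indicator {..g m j} (fst p) * D m j (snd p))
        = (\<Sum>j<N m. signed_ev I a M (\<lambda>p. indicator {..g m j} (fst p) * D m j (snd p)))"
      using int2 by (intro signed_ev_sum)
    finally have "signed_ev I a M (W m) = signed_ev I a M (\<lambda>p. w (g m (N m), snd p))
        - (\<Sum>j<N m. signed_ev I a M (\<lambda>p. indicator {..g m j} (fst p) * D m j (snd p)))" .
    moreover have "0 \<le> (\<Sum>j<N m. signed_ev I a M (\<lambda>p. indicator {..g m j} (fst p) * D m j (snd p)))"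
      by (intro sum_nonneg signed_ev_lower_set_antimono_nonneg[where C = "2 * C"] D) auto
    moreover have "signed_ev I a M (\<lambda>p. w (g m (N m), snd p)) \<le> 0"
    proof -
      \<comment> \<open>The leading term increases in the second coordinate alone. Subtracting it
        from \<open>C\<close> gives a nonnegative antitone function, and constants integrate to
        0.\<close>
      have "0 \<le> signed_ev I a M (\<lambda>p. indicator UNIV (fst p) * (C - w (g m (N m), snd p)))"
      proof (rule signed_ev_lower_set_antimono_nonneg)
        show "antimono (\<lambda>y. C - w (g m (N m), y))"
          by (auto simp: antimono_def intro: incr)
        show "0 \<le> C - w (g m (N m), y)" "C - w (g m (N m), y) \<le> 2 * C" for y
          using bounded[of "(g m (N m), y)"] by auto
      qed auto
      also have "\<dots> = signed_ev I a M (\<lambda>_. C) - signed_ev I a M (\<lambda>p. w (g m (N m), snd p))"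
        using int1 integrable_bounded[of _ "\<lambda>_. C" C] C by (subst signed_ev_diff[symmetric]) auto
      finally show ?thesis by (simp add: signed_ev_const)
    qed
    ultimately show ?thesis by linarith
  qed
  have lim: "(\<lambda>m. g m (k m x)) \<longlonglongrightarrow> x" for x
  proof -
    \<comment> \<open>Once \<open>x\<close> lies within the grid neither cap acts, and rounding
      moves it by at most one step.\<close>
    have "\<forall>\<^sub>F m in sequentially. \<bar>x\<bar> \<le> real m"
      using filterlim_real_sequentially by (simp add: filterlim_at_top)
    then have "\<forall>\<^sub>F m in sequentially. norm (g m (k m x) - x) \<le> 1 / real (Suc m)"
    proof eventually_elim
      case (elim m)
      define r where "r = real (Suc m)"
      have r: "0 < r" "\<bar>x\<bar> \<le> r" using elim by (auto simp: r_def)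
      have "r * (x + r) \<le> r * (2 * r)"
        using r by (intro mult_left_mono) auto
      then have "\<lceil>r * (x + r)\<rceil> \<le> int (N m)"
        unfolding ceiling_le_iff N_def by (simp add: r_def algebra_simps)
      moreover have "0 \<le> r * (x + r)"
        using r by (intro mult_nonneg_nonneg) auto
      ultimately have k: "real (k m x) = real_of_int \<lceil>r * (x + r)\<rceil>"
        by (simp add: k_def r_def[symmetric] nat_le_iff min_def del: of_nat_Suc)
      have "g m (k m x) - x = (real_of_int \<lceil>r * (x + r)\<rceil> - r * (x + r)) / r"
        using r unfolding g_def k r_def[symmetric] by (simp add: field_simps)
      moreover have "\<bar>real_of_int \<lceil>r * (x + r)\<rceil> - r * (x + r)\<bar> \<le> 1"
        by linarith
      ultimately show ?case
        using r by (simp add: r_def[symmetric] divide_right_mono del: of_nat_Suc)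
    qed
    moreover have "(\<lambda>m. 1 / real (Suc m)) \<longlonglongrightarrow> 0"
      using LIMSEQ_inverse_real_of_nat by (simp add: inverse_eq_divide)
    ultimately have "(\<lambda>m. g m (k m x) - x) \<longlonglongrightarrow> 0"
      by (rule Lim_null_comparison)
    then show ?thesis by (rule LIM_zero_cancel)
  qed
  show ?thesis
  proof (rule signed_ev_limit_nonpos[OF _ _ _ _ evW])
    show "W m \<in> borel_measurable borel" for m
      unfolding W_eq borel_prod[symmetric] by measurable
    \<comment> \<open>Continuity in the first coordinate is used here.\<close>
    show "(\<lambda>m. W m p) \<longlonglongrightarrow> w p" for p
      using isCont_tendsto_compose[OF cont lim, of "fst p" "snd p"] by (simp add: W_def)
    show "\<bar>W m p\<bar> \<le> C" for m p
      by (simp add: W_def bounded)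
    show "integrable (M i) (\<lambda>_. C)" if "i \<in> I" for i
      using integrable_bounded[OF that, of "\<lambda>_. C" C] C by simp
  qed
qed

text \<open>Truncating first from above by composition with a concave function and then from below
  in the coordinates keeps submodularity, and each step is dominated by the integrable
  function itself; truncating both ways in the coordinates would not be dominated.\<close>

lemma signed_ev_submodular_nonpos:
  assumes u: "submodular_utility u" and int: "\<And>i. i \<in> I \<Longrightarrow> integrable (M i) u"
  shows "signed_ev I a M u \<le> 0"
proof -
  \<comment> \<open>For \<open>v \<le> 0\<close>, clamping the coordinates from below moves the
    value up towards 0, so \<open>\<bar>v\<bar>\<close> dominates. The corner value
    \<open>v (- real L, - real L)\<close> bounds the clamped function from below.\<close>
  have below: "signed_ev I a M v \<le> 0"
    if v: "submodular_utility v" "\<And>p. v p \<le> 0" and int_v: "\<And>i. i \<in> I \<Longrightarrow> integrable (M i) v" for v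
  proof -
    define w where "w L p = v (max (fst p) (- real L), max (snd p) (- real L))" for L p
    have w: "submodular_utility (w L)" for L
      unfolding w_def by (rule submodular_utility_max_coords[OF v(1)])
    have incr: "x \<le> x' \<Longrightarrow> y \<le> y' \<Longrightarrow> v (x, y) \<le> v (x', y')" for x x' y y'
      using v(1) by (auto simp: submodular_utility_def)
    show ?thesis
    proof (rule signed_ev_limit_nonpos)
      show "w L \<in> borel_measurable borel" for L
        using w by (auto simp: submodular_utility_def)
      show "(\<lambda>L. w L p) \<longlonglongrightarrow> v p" for p
      proof (rule tendsto_eventually)
        have "\<forall>\<^sub>F L in sequentially. max \<bar>fst p\<bar> \<bar>snd p\<bar> \<le> real L"
          using filterlim_real_sequentially unfolding filterlim_at_top by blast
        then show "\<forall>\<^sub>F L in sequentially. w L p = v p"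
        proof eventually_elim
          case (elim L)
          then have "max (fst p) (- real L) = fst p" "max (snd p) (- real L) = snd p"
            by linarith+
          then show ?case by (simp add: w_def)
        qed
      qed
      show "\<bar>w L p\<bar> \<le> \<bar>v p\<bar>" for L p
      proof -
        have "v (fst p, snd p) \<le> w L p"
          unfolding w_def by (rule incr) auto
        then show ?thesis using v(2) by (simp add: w_def)
      qed
      show "integrable (M i) (\<lambda>p. \<bar>v p\<bar>)" if "i \<in> I" for i
        using int_v[OF that] by simp
      show "signed_ev I a M (w L) \<le> 0" for L
      proof (rule signed_ev_bounded_submodular_nonpos[OF w])
        fix p
        have "v (- real L, - real L) \<le> w L p"
          unfolding w_def by (rule incr) auto
        then show "\<bar>w L p\<bar> \<le> - v (- real L, - real L)"
          using v(2) by (simp add: w_def)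
      qed
    qed
  qed
  have u_meas: "u \<in> borel_measurable borel"
    using u by (auto simp: submodular_utility_def)
  have int_min: "integrable (M i) (\<lambda>p. min (u p) (real K))" if "i \<in> I" for i K
    by (rule Bochner_Integration.integrable_bound[OF int[OF that]])
       (use u_meas in \<open>auto intro!: measurable_M[OF that]\<close>)
  have int_const: "integrable (M i) (\<lambda>_. c)" if "i \<in> I" for i and c :: real
    by (rule integrable_bounded[OF that, of _ "\<bar>c\<bar>"]) auto
  show ?thesis
  proof (rule signed_ev_limit_nonpos)
    show "(\<lambda>p. min (u p) (real K)) \<in> borel_measurable borel" for K
      using u_meas by auto
    show "(\<lambda>K. min (u p) (real K)) \<longlonglongrightarrow> u p" for p
    proof (rule tendsto_eventually)
      have "\<forall>\<^sub>F K in sequentially. u p \<le> real K"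
        using filterlim_real_sequentially unfolding filterlim_at_top by blast
      then show "\<forall>\<^sub>F K in sequentially. min (u p) (real K) = u p"
        by eventually_elim simp
    qed
    show "\<bar>min (u p) (real K)\<bar> \<le> \<bar>u p\<bar>" for K p
      by auto
    show "integrable (M i) (\<lambda>p. \<bar>u p\<bar>)" if "i \<in> I" for i
      using int[OF that] by simp
    show "signed_ev I a M (\<lambda>p. min (u p) (real K)) \<le> 0" for K
    proof -
      \<comment> \<open>The shift by \<open>real K\<close> gives the sign that \<open>below\<close>
        requires and contributes nothing, as the total weight is 0.\<close>
      have "signed_ev I a M (\<lambda>p. min (u p) (real K) - real K) \<le> 0"
        by (rule below[OF submodular_utility_min[OF u]])
           (auto intro: int_min int_const)
      then show ?thesis
        by (subst (asm) signed_ev_diff) (auto simp: signed_ev_const intro: int_min int_const)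
    qed
  qed
qed

end

text \<open>The signed family is \<open>Y - X\<close>, weighted by \<open>lam\<close>, together with the Dirac masses \<open>d\<close> at \<open>q1\<close> and \<open>- d\<close> at \<open>q0\<close>.\<close>

lemma mixture_expectation_le:
  fixes X Y :: "nat \<Rightarrow> (real \<times> real) measure" and lam :: "nat \<Rightarrow> real"
  assumes X: "\<And>i. i < n \<Longrightarrow> prob_space (X i)" "\<And>i. i < n \<Longrightarrow> sets (X i) = sets borel"
    and Y: "\<And>i. i < n \<Longrightarrow> prob_space (Y i)" "\<And>i. i < n \<Longrightarrow> sets (Y i) = sets borel"
    and u: "submodular_utility u"
      "\<And>i. i < n \<Longrightarrow> integrable (X i) u" "\<And>i. i < n \<Longrightarrow> integrable (Y i) u"
    and cdf: "\<And>p. mix_cdf n lam X p + d * cdf2 (return borel q0) p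
      \<le> mix_cdf n lam Y p + d * cdf2 (return borel q1) p"
  shows "(\<Sum>i<n. lam i * (\<integral>x. u x \<partial>Y i)) + d * u q1 \<le> (\<Sum>i<n. lam i * (\<integral>x. u x \<partial>X i)) + d * u q0"
proof -
  \<comment> \<open>The three summands index the laws \<open>X i\<close>, the laws
    \<open>Y i\<close> and the two Dirac masses, with \<open>True\<close> for \<open>q1\<close> and
    \<open>False\<close> for \<open>q0\<close>.\<close>
  define I where "I = {..<n} <+> ({..<n} <+> (UNIV :: bool set))"
  define a where "a = case_sum (\<lambda>i. - lam i) (case_sum lam (\<lambda>b. if b then d else - d))"
  define M where "M = case_sum X (case_sum Y (\<lambda>b. return borel (if b then q1 else q0)))"
  have sum_I: "(\<Sum>i\<in>I. a i * f i) = - (\<Sum>i<n. lam i * f (Inl i))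
      + ((\<Sum>i<n. lam i * f (Inr (Inl i))) + (d * f (Inr (Inr True)) - d * f (Inr (Inr False))))" for f
    unfolding I_def a_def by (simp add: sum.Plus UNIV_bool sum_negf)
  have u_meas: "u \<in> borel_measurable borel"
    using u(1) by (auto simp: submodular_utility_def)
  have int_return: "integrable (return borel q) u" for q
    using u_meas by (intro integrableI_bounded) (simp_all add: nn_integral_return)
  have "signed_ev I a M u \<le> 0"
  proof (rule signed_ev_submodular_nonpos[OF _ _ _ _ _ u(1)])
    show "finite I" by (simp add: I_def)
    show "prob_space (M i)" "sets (M i) = sets borel" if "i \<in> I" for i
      using that X Y by (auto simp: I_def M_def prob_space_return)
    show "sum a I = 0" using sum_I[of "\<lambda>_. 1"] by simp
    show "0 \<le> (\<Sum>i\<in>I. a i * cdf2 (M i) p)" for p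
      using cdf[of p] by (simp add: sum_I M_def mix_cdf_def)
    show "integrable (M i) u" if "i \<in> I" for i
      using that u(2,3) int_return[of q0] int_return[of q1] by (auto simp: I_def M_def)
  qed
  then show ?thesis
    unfolding signed_ev_def sum_I using u_meas by (simp add: M_def integral_return)
qed

section \<open>Joint and marginal CDFs\<close>

text \<open>Putting the coordinate selected by \<open>coord j\<close> first lets one argument serve
  both marginals.\<close>

definition coord_point :: "nat \<Rightarrow> real \<Rightarrow> real \<Rightarrow> real \<times> real" where
  "coord_point j s t = (if j = 1 then (s, t) else (t, s))"

lemma closed_coord: "closed {y. coord j y \<le> s}"
  unfolding coord_def by (cases "j = 1") (auto intro!: closed_Collect_le continuous_intros)

lemma closed_fst_snd: "closed {y :: real \<times> real. fst y \<le> s \<and> snd y \<le> t}"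
  by (intro closed_Collect_conj closed_Collect_le continuous_intros)

lemma cdf2_return: "cdf2 (return borel q) p = of_bool (fst q \<le> fst p \<and> snd q \<le> snd p)"
  by (simp add: cdf2_def measure_return indicator_def borel_closed closed_fst_snd)

context
  fixes M :: "(real \<times> real) measure"
  assumes M: "prob_space M" "sets M = sets borel"
begin

interpretation prob_space M by (rule M(1))

lemma sets_coord: "{y. coord j y \<le> s} \<in> sets M"
  using closed_coord by (simp add: M(2))

lemma cdf2_le_marg_cdf: "s \<le> s' \<Longrightarrow> cdf2 M (coord_point j s t) \<le> marg_cdf j M s'"
  unfolding cdf2_def marg_cdf_def
  by (rule finite_measure_mono[OF _ sets_coord]) (auto simp: coord_def coord_point_def)

lemma cdf2_mono: "fst p \<le> fst q \<Longrightarrow> snd p \<le> snd q \<Longrightarrow> cdf2 M p \<le> cdf2 M q"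
  unfolding cdf2_def
  by (rule finite_measure_mono) (auto simp: M(2) intro: borel_closed closed_fst_snd)

text \<open>Continuity from above of the measure along shrinking half-planes.\<close>

lemma marg_cdf_right_limit: "(\<lambda>k. marg_cdf j M (s + 1 / real (Suc k))) \<longlonglongrightarrow> marg_cdf j M s"
proof -
  let ?A = "\<lambda>k. {y. coord j y \<le> s + 1 / real (Suc k)}"
  have "(\<lambda>k. measure M (?A k)) \<longlonglongrightarrow> measure M (\<Inter>k. ?A k)"
  proof (rule finite_Lim_measure_decseq)
    show "range ?A \<subseteq> sets M" using sets_coord by auto
    have "1 / real (Suc n) \<le> 1 / real (Suc m)" if "m \<le> n" for m n
      using that by (simp add: frac_le)
    then show "decseq ?A"
      by (fastforce simp: decseq_def)
  qed
  also have "(\<Inter>k. ?A k) = {y. coord j y \<le> s}"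
  proof -
    have "x \<le> s" if "\<And>k. x \<le> s + 1 / real (Suc k)" for x
    proof (rule LIMSEQ_le_const)
      show "(\<lambda>k. s + 1 / real (Suc k)) \<longlonglongrightarrow> s"
        using LIMSEQ_inverse_real_of_nat_add[of s] by (simp add: inverse_eq_divide)
    qed (use that in blast)
    moreover have "x \<le> s + 1 / real (Suc k)" if "x \<le> s" for x k
      using that by (simp add: add_increasing2)
    ultimately show ?thesis by blast
  qed
  finally show ?thesis by (simp add: marg_cdf_def)
qed

text \<open>Continuity from below: the orthants exhaust a half-plane as the other coordinate
  grows.\<close>

lemma cdf2_limit_marg_cdf: "(\<lambda>k. cdf2 M (coord_point j s (real k))) \<longlonglongrightarrow> marg_cdf j M s"
proof -
  let ?A = "\<lambda>k. {y. fst y \<le> fst (coord_point j s (real k)) \<and> snd y \<le> snd (coord_point j s (real k))}"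
  have "(\<lambda>k. measure M (?A k)) \<longlonglongrightarrow> measure M (\<Union>k. ?A k)"
  proof (rule finite_Lim_measure_incseq)
    show "range ?A \<subseteq> sets M"
      by (auto simp: M(2) intro: borel_closed closed_fst_snd)
    show "incseq ?A"
      by (auto simp: incseq_def coord_point_def)
  qed
  also have "(\<Union>k. ?A k) = {y. coord j y \<le> s}"
    by (cases "j = 1") (auto simp: coord_def coord_point_def real_arch_simple)
  finally show ?thesis by (simp add: cdf2_def marg_cdf_def)
qed

end

section \<open>Strict inequality between the mixtures\<close>

lemma mixture_expectation_less:
  fixes X Y :: "nat \<Rightarrow> (real \<times> real) measure" and lam :: "nat \<Rightarrow> real"
  assumes X: "\<And>i. i < n \<Longrightarrow> prob_space (X i)" "\<And>i. i < n \<Longrightarrow> sets (X i) = sets borel"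
    and Y: "\<And>i. i < n \<Longrightarrow> prob_space (Y i)" "\<And>i. i < n \<Longrightarrow> sets (Y i) = sets borel"
    and lam: "\<And>i. i < n \<Longrightarrow> 0 \<le> lam i" and dom: "mix_succ_d n lam X Y"
    and u: "submodular_utility u"
      "\<And>i. i < n \<Longrightarrow> integrable (X i) u" "\<And>i. i < n \<Longrightarrow> integrable (Y i) u"
    and incr: "strictly_incr u"
  shows "(\<Sum>i<n. lam i * (\<integral>x. u x \<partial>Y i)) < (\<Sum>i<n. lam i * (\<integral>x. u x \<partial>X i))"
proof -
  have fsd: "mix_cdf n lam X p \<le> mix_cdf n lam Y p" for p
    using dom unfolding mix_succ_d_def fsd_ge_def by blast
  obtain j t0 where t0: "mix_marg_cdf n lam X j t0 < mix_marg_cdf n lam Y j t0"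
    using dom by (auto simp: mix_succ_d_def fsd_gt_def)
  \<comment> \<open>Half of the gap becomes the Dirac mass; the other half pays for two errors below
    \<open>d / 2\<close>, one from moving \<open>t0\<close> to \<open>t1\<close> and one from
    cutting off at \<open>T\<close>.\<close>
  define d where "d = (mix_marg_cdf n lam Y j t0 - mix_marg_cdf n lam X j t0) / 2"
  have d2: "mix_marg_cdf n lam Y j t0 = mix_marg_cdf n lam X j t0 + 2 * d"
    by (simp add: d_def field_simps)
  have d: "0 < d" using t0 by (simp add: d_def)
  obtain t1 where t1: "t0 < t1" "mix_marg_cdf n lam X j t1 < mix_marg_cdf n lam X j t0 + d / 2"
  proof -
    have "(\<lambda>k. mix_marg_cdf n lam X j (t0 + 1 / real (Suc k))) \<longlonglongrightarrow> mix_marg_cdf n lam X j t0"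
      unfolding mix_marg_cdf_def
      by (intro tendsto_sum tendsto_mult tendsto_const marg_cdf_right_limit X) auto
    then have "\<forall>\<^sub>F k in sequentially.
        mix_marg_cdf n lam X j (t0 + 1 / real (Suc k)) < mix_marg_cdf n lam X j t0 + d / 2"
      by (rule order_tendstoD) (use d in simp)
    then obtain k where "mix_marg_cdf n lam X j (t0 + 1 / real (Suc k)) < mix_marg_cdf n lam X j t0 + d / 2"
      using eventually_happens'[OF sequentially_bot] by blast
    then show ?thesis using that[of "t0 + 1 / real (Suc k)"] by simp
  qed
  obtain T where T: "mix_marg_cdf n lam Y j t0 - d / 2 < mix_cdf n lam Y (coord_point j t0 T)"
  proof -
    have "(\<lambda>k. mix_cdf n lam Y (coord_point j t0 (real k))) \<longlonglongrightarrow> mix_marg_cdf n lam Y j t0"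
      unfolding mix_marg_cdf_def mix_cdf_def
      by (intro tendsto_sum tendsto_mult tendsto_const cdf2_limit_marg_cdf Y) auto
    then have "\<forall>\<^sub>F k in sequentially.
        mix_marg_cdf n lam Y j t0 - d / 2 < mix_cdf n lam Y (coord_point j t0 (real k))"
      by (rule order_tendstoD) (use d in simp)
    then show ?thesis using that eventually_happens'[OF sequentially_bot] by blast
  qed
  let ?q0 = "coord_point j t0 T" and ?q1 = "coord_point j t1 T"
  have cdf: "mix_cdf n lam X p + d * cdf2 (return borel ?q0) p
      \<le> mix_cdf n lam Y p + d * cdf2 (return borel ?q1) p" for p
  proof -
    obtain s t where p: "p = coord_point j s t"
      by (metis coord_point_def prod.collapse)
    \<comment> \<open>Only in the strip of this case distinction does the orthant below
      \<open>p\<close> contain \<open>?q0\<close> but not \<open>?q1\<close>; elsewhere the added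
      masses respect the given order.\<close>
    show ?thesis
    proof (cases "t0 \<le> s \<and> s < t1 \<and> T \<le> t")
      case True
      have "mix_cdf n lam X p \<le> mix_marg_cdf n lam X j t1"
        unfolding mix_cdf_def mix_marg_cdf_def p
        using True by (intro sum_mono mult_left_mono lam cdf2_le_marg_cdf X) auto
      moreover have "mix_cdf n lam Y ?q0 \<le> mix_cdf n lam Y p"
        unfolding mix_cdf_def p
        using True by (intro sum_mono mult_left_mono lam cdf2_mono Y) (auto simp: coord_point_def)
      \<comment> \<open>The \<open>X\<close> side is below its marginal at \<open>t0\<close> plus
        \<open>d / 2\<close>, and the \<open>Y\<close> side is above that same value plus
        \<open>3 * d / 2\<close>.\<close>
      ultimately have "mix_cdf n lam X p + d \<le> mix_cdf n lam Y p"
        using t1(2) T d2 by linarith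
      moreover have "d * cdf2 (return borel ?q0) p \<le> d" "0 \<le> d * cdf2 (return borel ?q1) p"
        using d by (simp_all add: cdf2_return)
      ultimately show ?thesis by linarith
    next
      case False
      then have "cdf2 (return borel ?q0) p \<le> cdf2 (return borel ?q1) p"
        using t1(1) unfolding p by (auto simp: cdf2_return coord_point_def split: if_splits)
      then show ?thesis
        using d fsd[of p] by (intro add_mono mult_left_mono) auto
    qed
  qed
  have "(\<Sum>i<n. lam i * (\<integral>x. u x \<partial>Y i)) + d * u ?q1 \<le> (\<Sum>i<n. lam i * (\<integral>x. u x \<partial>X i)) + d * u ?q0"
    by (rule mixture_expectation_le[OF X Y u cdf])
  moreover have "pareto_gt ?q1 ?q0"
    using t1(1) by (auto simp: pareto_gt_def coord_point_def)
  then have "d * u ?q0 < d * u ?q1"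
    using d incr unfolding strictly_incr_def by (intro mult_strict_left_mono) blast+
  ultimately show ?thesis by linarith
qed

section \<open>From the mixed partial derivative to the theorem\<close>

text \<open>The mixed derivative makes the first partial derivative antitone in the second
  coordinate. For \<open>y \<le> y'\<close> the difference \<open>u (t, y') - u (t, y)\<close>
  therefore has nonpositive derivative in \<open>t\<close>, and its decrease is
  submodularity.\<close>

lemma submodular_utility_of_mixed_partial:
  assumes incr: "strictly_incr u" and mixed: "mixed_partial_nonpos u"
    and meas: "u \<in> borel_measurable borel"
  shows "submodular_utility u"
  unfolding submodular_utility_def
proof (intro conjI allI impI)
  have diff: "(\<lambda>t. u (t, y)) differentiable (at x)" for x y
    using mixed by (auto simp: mixed_partial_nonpos_def)
  show "isCont (\<lambda>x. u (x, y)) x" for x y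
    by (rule differentiable_imp_continuous_within[OF diff])
  fix x x' y y' :: real
  assume le: "x \<le> x'" "y \<le> y'"
  show "u (x, y) \<le> u (x', y')"
  proof (cases "x = x' \<and> y = y'")
    case False
    then have "pareto_gt (x', y') (x, y)"
      using le by (auto simp: pareto_gt_def)
    then show ?thesis
      using incr by (auto simp: strictly_incr_def intro: less_imp_le)
  qed auto
  have "deriv (\<lambda>t. u (t, y')) z \<le> deriv (\<lambda>t. u (t, y)) z" for z
    by (rule DERIV_nonpos_imp_nonincreasing[OF le(2)])
       (use mixed in \<open>auto simp: mixed_partial_nonpos_def\<close>)
  moreover have "((\<lambda>t. u (t, y)) has_real_derivative deriv (\<lambda>t. u (t, y)) z) (at z)" for y z
    using diff[of y z] by (simp add: DERIV_deriv_iff_real_differentiable)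
  ultimately have "\<exists>c. ((\<lambda>t. u (t, y') - u (t, y)) has_real_derivative c) (at z) \<and> c \<le> 0" for z
    by (intro exI[of _ "deriv (\<lambda>t. u (t, y')) z - deriv (\<lambda>t. u (t, y)) z"] conjI DERIV_diff) simp_all
  then have "u (x', y') - u (x', y) \<le> u (x, y') - u (x, y)"
    by (intro DERIV_nonpos_imp_nonincreasing[OF le(1)]) auto
  then show "u (x', y') + u (x, y) \<le> u (x', y) + u (x, y')"
    by simp
qed (rule meas)

theorem theorem5p1:
  fixes n :: nat and X Y :: "nat \<Rightarrow> (real \<times> real) measure" and lam :: "nat \<Rightarrow> real"
    and u :: "real \<times> real \<Rightarrow> real"
  assumes "\<forall>i<n. prob_space (X i) \<and> sets (X i) = sets borel"
    and "\<forall>i<n. prob_space (Y i) \<and> sets (Y i) = sets borel"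
    and "lam \<in> std_simplex n"
    and "mix_succ_d n lam X Y"
    and "strictly_incr u"
    and "mixed_partial_nonpos u"
    and "\<forall>i<n. integrable (X i) u \<and> integrable (Y i) u"
  shows "\<exists>i<n. (\<integral>x. u x \<partial>X i) > (\<integral>x. u x \<partial>Y i)"
proof (rule ccontr)
  assume contr: "\<not> ?thesis"
  \<comment> \<open>The weights sum to 1, so some law exists; integrability of \<open>u\<close>
    under \<open>X 0\<close> supplies its Borel measurability.\<close>
  have "0 < n"
    using assms(3) by (cases n) (auto simp: std_simplex_def)
  then have "sets (X 0) = sets borel" "integrable (X 0) u"
    using assms(1,7) by auto
  then have "u \<in> borel_measurable borel"
    using measurable_cong_sets[of "X 0" borel borel borel] by blast
  then have "submodular_utility u"
    using assms(5,6) by (intro submodular_utility_of_mixed_partial)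
  moreover have lam: "0 \<le> lam i" if "i < n" for i
    using assms(3) that by (auto simp: std_simplex_def)
  ultimately have "(\<Sum>i<n. lam i * (\<integral>x. u x \<partial>Y i)) < (\<Sum>i<n. lam i * (\<integral>x. u x \<partial>X i))"
    using assms(1,2,4,5,7) by (intro mixture_expectation_less) blast+
  \<comment> \<open>If no index worked, averaging with the nonnegative weights would reverse the
    strict inequality.\<close>
  moreover have "(\<Sum>i<n. lam i * (\<integral>x. u x \<partial>X i)) \<le> (\<Sum>i<n. lam i * (\<integral>x. u x \<partial>Y i))"
  proof (intro sum_mono mult_left_mono lam)
    show "(\<integral>x. u x \<partial>X i) \<le> (\<integral>x. u x \<partial>Y i)" if "i \<in> {..<n}" for i
      using contr that by (meson lessThan_iff not_le)
  qed simp
  ultimately show False by linarith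
qed

end
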